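(* Let $G=(A\cup B,E)$ with $|A|=|B|=n$, let $M$ be an assignment in $G$ and $k$ a nonnegative integer. Then $\mu(M)\le k$ if and only if there exists a feasible solution $\vec\alpha$ to the linear program $\min\sum_{u\in A\cup B}y_u$ subject to $y_a+y_b\ge\mathsf{wt}_M(a,b)$ for all $(a,b)\in E$, such that $\alpha_a\in\{0,1,\dots,n\}$ for all $a\in A$, $\alpha_b\in\{0,-1,\dots,-(n-1)\}$ for all $b\in B$, and $\sum_{u\in A\cup B}\alpha_u\le k$.
   Context: Each agent $a\in A$ has a strict partial order $\succ_a$ over her neighbors; objects have no preferences. An assignment is a perfect matching. For $(a,b)\in E$: $\mathsf{wt}_M(a,b)=1$ if $b\succ_aM(a)$, $-1$ if $M(a)\succ_ab$, $0$ otherwise. For matchings $M,N$, agent $a$ prefers $M$ to $N$ if matched in $M$ and either unmatched in $N$ or $M(a)\succ_aN(a)$; $\Delta(M,N)$ is the number of agents preferring $M$ minus the number preferring $N$. The unpopularity margin is $\mu(M)=\max_N\Delta(N,M)$ over all perfect matchings $N$. *)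

theory Defs
  imports Complex_Main
begin

text \<open>
  Agents and objects have separate types, so the two sides of the graph are disjoint;
  the vertex set is the disjoint sum \<open>A <+> B\<close>, and an edge is a pair (agent, object).
  \<open>pref a b c\<close> means that agent \<open>a\<close> strictly prefers \<open>b\<close> to \<open>c\<close>.
\<close>

definition bipartite_graph :: "'a set \<Rightarrow> 'b set \<Rightarrow> ('a \<times> 'b) set \<Rightarrow> bool" where
  "bipartite_graph A B E \<longleftrightarrow> finite A \<and> finite B \<and> E \<subseteq> A \<times> B"

definition neighbors :: "('a \<times> 'b) set \<Rightarrow> 'a \<Rightarrow> 'b set" where
  "neighbors E a = {b. (a, b) \<in> E}"

definition preferences ::
  "'a set \<Rightarrow> ('a \<times> 'b) set \<Rightarrow> ('a \<Rightarrow> 'b \<Rightarrow> 'b \<Rightarrow> bool) \<Rightarrow> bool" where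
  "preferences A E pref \<longleftrightarrow>
     (\<forall>a\<in>A. irreflp_on (neighbors E a) (pref a) \<and> transp_on (neighbors E a) (pref a))"

definition matching :: "('a \<times> 'b) set \<Rightarrow> ('a \<times> 'b) set \<Rightarrow> bool" where
  "matching E M \<longleftrightarrow> M \<subseteq> E \<and> inj_on fst M \<and> inj_on snd M"

definition perfect_matching ::
  "'a set \<Rightarrow> 'b set \<Rightarrow> ('a \<times> 'b) set \<Rightarrow> ('a \<times> 'b) set \<Rightarrow> bool" where
  "perfect_matching A B E M \<longleftrightarrow> matching E M \<and> fst ` M = A \<and> snd ` M = B"

definition matched :: "('a \<times> 'b) set \<Rightarrow> 'a \<Rightarrow> bool" where
  "matched M a \<longleftrightarrow> a \<in> fst ` M"

text \<open>The partner \<open>M(a)\<close>; only meaningful if \<open>M\<close> is a matching that matches \<open>a\<close>.\<close>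

definition partner :: "('a \<times> 'b) set \<Rightarrow> 'a \<Rightarrow> 'b" where
  "partner M a = (THE b. (a, b) \<in> M)"

definition wt :: "('a \<Rightarrow> 'b \<Rightarrow> 'b \<Rightarrow> bool) \<Rightarrow> ('a \<times> 'b) set \<Rightarrow> 'a \<Rightarrow> 'b \<Rightarrow> int" where
  "wt pref M a b =
     (if pref a b (partner M a) then 1 else if pref a (partner M a) b then - 1 else 0)"

definition prefers_matching ::
  "('a \<Rightarrow> 'b \<Rightarrow> 'b \<Rightarrow> bool) \<Rightarrow> 'a \<Rightarrow> ('a \<times> 'b) set \<Rightarrow> ('a \<times> 'b) set \<Rightarrow> bool" where
  "prefers_matching pref a M N \<longleftrightarrow>
     matched M a \<and> (\<not> matched N a \<or> pref a (partner M a) (partner N a))"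

definition Delta ::
  "'a set \<Rightarrow> ('a \<Rightarrow> 'b \<Rightarrow> 'b \<Rightarrow> bool) \<Rightarrow> ('a \<times> 'b) set \<Rightarrow> ('a \<times> 'b) set \<Rightarrow> int" where
  "Delta A pref M N =
     int (card {a \<in> A. prefers_matching pref a M N}) -
     int (card {a \<in> A. prefers_matching pref a N M})"

text \<open>
  For a finite graph having a perfect matching, the maximum below ranges over a finite
  nonempty set.
\<close>

definition unpopularity_margin ::
  "'a set \<Rightarrow> 'b set \<Rightarrow> ('a \<times> 'b) set \<Rightarrow> ('a \<Rightarrow> 'b \<Rightarrow> 'b \<Rightarrow> bool) \<Rightarrow> ('a \<times> 'b) set \<Rightarrow> int" where
  "unpopularity_margin A B E pref M =
     Max {Delta A pref N M | N. perfect_matching A B E N}"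

definition LP_feasible ::
  "('a \<times> 'b) set \<Rightarrow> ('a \<Rightarrow> 'b \<Rightarrow> 'b \<Rightarrow> bool) \<Rightarrow> ('a \<times> 'b) set \<Rightarrow> ('a + 'b \<Rightarrow> real) \<Rightarrow> bool" where
  "LP_feasible E pref M y \<longleftrightarrow>
     (\<forall>(a, b)\<in>E. y (Inl a) + y (Inr b) \<ge> real_of_int (wt pref M a b))"

definition LP_objective :: "'a set \<Rightarrow> 'b set \<Rightarrow> ('a + 'b \<Rightarrow> real) \<Rightarrow> real" where
  "LP_objective A B y = (\<Sum>u\<in>A <+> B. y u)"

end

theory Submission
  imports Defs
begin

text \<open>
  For a perfect matching \<open>N\<close>, \<open>\<Delta>(N, M)\<close> is the weight of \<open>N\<close> under \<open>wt\<close>, so the claim is LP duality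
  for maximum-weight perfect matchings with a bounded integral optimum. An integral dual solution
  of minimal value has a perfect matching among its tight edges, since a violator of Hall's
  condition would yield a cheaper one. Its values are then compressed until the object side
  has no gaps.
\<close>

section \<open>Hall's marriage theorem\<close>

text \<open>Induction on the size of \<open>A\<close>: if a nonempty proper subset is tight, it and
  its complement are matched separately; otherwise every nonempty proper subset has a spare neighbor
  and any single pair can be fixed first.\<close>

lemma hall_marriage:
  assumes "finite A" "\<And>a. a \<in> A \<Longrightarrow> finite (N a)"
    and "\<And>S. S \<subseteq> A \<Longrightarrow> card S \<le> card (\<Union>a\<in>S. N a)"
  shows "\<exists>f. inj_on f A \<and> (\<forall>a\<in>A. f a \<in> N a)"
  using assms
proof (induction "card A" arbitrary: A N rule: less_induct)
  case less
  note fin = less.prems(1,2) and hall = less.prems(3)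
  show ?case
  proof (cases "A = {}")
    case True
    then show ?thesis by simp
  next
    case False
    show ?thesis
    proof (cases "\<exists>S. S \<noteq> {} \<and> S \<subset> A \<and> card S = card (\<Union>a\<in>S. N a)")
      case True
      then obtain S where S: "S \<noteq> {}" "S \<subset> A" "card S = card (\<Union>a\<in>S. N a)" by blast
      have finS: "finite S" using S(2) fin(1) finite_subset by blast
      define T where "T = (\<Union>a\<in>S. N a)"
      have finT: "finite T" unfolding T_def using S(2) fin(2) finS by blast
      have "\<exists>f. inj_on f S \<and> (\<forall>a\<in>S. f a \<in> N a)"
      proof (rule less.hyps)
        show "card S < card A" using S(2) fin(1) by (rule psubset_card_mono[rotated])
      qed (use S(2) finS fin hall in auto)
      then obtain f where f: "inj_on f S" "\<forall>a\<in>S. f a \<in> N a" by blast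
      have "\<exists>g. inj_on g (A - S) \<and> (\<forall>a\<in>A - S. g a \<in> N a - T)"
      proof (rule less.hyps)
        have "A - S \<subset> A" using S(1,2) by blast
        then show "card (A - S) < card A" using fin(1) by (rule psubset_card_mono[rotated])
      next
        fix R assume R: "R \<subseteq> A - S"
        have finR: "finite R" using R fin(1) finite_subset by blast
        have finNR: "finite (\<Union>a\<in>R. N a - T)" using R fin(2) finR by blast
        \<comment> \<open>Subtracting the tight equality for \<open>S\<close> from Hall's condition
          for \<open>R \<union> S\<close> leaves the condition for \<open>R\<close> with the objects
          of \<open>T\<close> removed.\<close>
        have "card R + card S = card (R \<union> S)"
          using R finR finS by (subst card_Un_disjoint) auto
        also have "\<dots> \<le> card (\<Union>a\<in>R \<union> S. N a)" using R S(2) by (intro hall) blast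
        also have "(\<Union>a\<in>R \<union> S. N a) = (\<Union>a\<in>R. N a - T) \<union> T" unfolding T_def by blast
        also have "card \<dots> = card (\<Union>a\<in>R. N a - T) + card T"
          using finNR finT by (intro card_Un_disjoint) auto
        finally show "card R \<le> card (\<Union>a\<in>R. N a - T)" using S(3) T_def by simp
      qed (use fin in auto)
      then obtain g where g: "inj_on g (A - S)" "\<forall>a\<in>A - S. g a \<in> N a - T" by blast
      let ?h = "\<lambda>a. if a \<in> S then f a else g a"
      have "f a \<noteq> g b" if "a \<in> S" "b \<in> A - S" for a b
        using f(2) g(2) that unfolding T_def by auto
      then have "inj_on ?h A"
        using f(1) g(1) unfolding inj_on_def by (metis DiffI)
      moreover have "\<forall>a\<in>A. ?h a \<in> N a" using f(2) g(2) by auto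
      ultimately show ?thesis by blast
    next
      case slack: False
      obtain x where x: "x \<in> A" using False by blast
      have "card {x} \<le> card (\<Union>a\<in>{x}. N a)" using x by (intro hall) blast
      then have "N x \<noteq> {}" by auto
      then obtain y where y: "y \<in> N x" by blast
      \<comment> \<open>Deleting \<open>y\<close> costs each remaining set at most one neighbor,
        which its strict surplus covers.\<close>
      have "\<exists>g. inj_on g (A - {x}) \<and> (\<forall>a\<in>A - {x}. g a \<in> N a - {y})"
      proof (rule less.hyps)
        show "card (A - {x}) < card A" using x fin(1) by (intro card_Diff1_less)
      next
        fix R assume R: "R \<subseteq> A - {x}"
        show "card R \<le> card (\<Union>a\<in>R. N a - {y})"
        proof (cases "R = {}")
          case False
          have "R \<subset> A" using R x by blast
          then have "card R < card (\<Union>a\<in>R. N a)"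
            using slack hall[of R] False by (metis le_neq_implies_less psubset_imp_subset)
          moreover have "(\<Union>a\<in>R. N a - {y}) = (\<Union>a\<in>R. N a) - {y}" by blast
          moreover have "card (\<Union>a\<in>R. N a) - 1 \<le> card ((\<Union>a\<in>R. N a) - {y})"
            by (simp add: card_Diff_singleton_if)
          ultimately show ?thesis by simp
        qed simp
      qed (use fin in auto)
      then obtain g where g: "inj_on g (A - {x})" "\<forall>a\<in>A - {x}. g a \<in> N a - {y}" by blast
      have "inj_on (g(x := y)) A"
        using g unfolding inj_on_def by auto
      moreover have "\<forall>a\<in>A. (g(x := y)) a \<in> N a" using g(2) y by auto
      ultimately show ?thesis by blast
    qed
  qed
qed

section \<open>Weak and strong duality for perfect matchings\<close>

lemma sum_perfect_matching:
  fixes p :: "'a \<Rightarrow> 'c :: comm_monoid_add"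
  assumes "perfect_matching A B E N"
  shows "(\<Sum>(a, b)\<in>N. p a + q b) = sum p A + sum q B"
proof -
  have N: "inj_on fst N" "inj_on snd N" "fst ` N = A" "snd ` N = B"
    using assms by (auto simp: perfect_matching_def matching_def)
  have "(\<Sum>e\<in>N. p (fst e)) = sum p A" "(\<Sum>e\<in>N. q (snd e)) = sum q B"
    using sum.reindex[OF N(1), of p] sum.reindex[OF N(2), of q] N(3,4) by simp_all
  then show ?thesis by (simp add: split_def sum.distrib)
qed

lemma sum_add_indicator:
  fixes p :: "'a \<Rightarrow> int"
  assumes "finite A"
  shows "(\<Sum>a\<in>A. p a + (if P a then c else 0)) = sum p A + c * int (card {a \<in> A. P a})"
  using assms by (simp add: sum.distrib sum.inter_filter[symmetric])

text \<open>A perfect matching covers every vertex exactly once, so summing the edge constraints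
  along it gives the whole dual value. The type is general because both integer and real potentials
  occur.\<close>

lemma weak_duality:
  fixes w :: "'a \<Rightarrow> 'b \<Rightarrow> 'c :: ordered_comm_monoid_add"
  assumes "\<And>a b. (a, b) \<in> E \<Longrightarrow> w a b \<le> p a + q b"
    and "perfect_matching A B E N"
  shows "(\<Sum>(a, b)\<in>N. w a b) \<le> sum p A + sum q B"
proof -
  have "N \<subseteq> E" using assms(2) by (auto simp: perfect_matching_def matching_def)
  then have "(\<Sum>(a, b)\<in>N. w a b) \<le> (\<Sum>(a, b)\<in>N. p a + q b)"
    using assms(1) by (intro sum_mono) auto
  then show ?thesis using sum_perfect_matching[OF assms(2)] by metis
qed

theorem egervary:
  fixes w :: "'a \<Rightarrow> 'b \<Rightarrow> int"
  assumes G: "bipartite_graph A B E" and M: "perfect_matching A B E M"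
  obtains p q N where
    "\<And>a b. (a, b) \<in> E \<Longrightarrow> w a b \<le> p a + q b"
    "perfect_matching A B E N"
    "(\<Sum>(a, b)\<in>N. w a b) = sum p A + sum q B"
proof -
  have finA: "finite A" and finB: "finite B" and E: "E \<subseteq> A \<times> B"
    using G by (auto simp: bipartite_graph_def)
  have finE: "finite E" using E finA finB finite_subset by blast
  define feas where "feas = (\<lambda>(p, q). \<forall>(a, b)\<in>E. w a b \<le> p a + q b)"
  \<comment> \<open>By weak duality the weight of \<open>M\<close> bounds every feasible dual value
    from below, so \<open>nat\<close> truncates nothing on feasible pairs and a least value
    exists.\<close>
  define obj where "obj = (\<lambda>(p, q). nat (sum p A + sum q B - (\<Sum>(a, b)\<in>M. w a b)))"
  \<comment> \<open>The inserted 0 keeps the maximum defined when \<open>E\<close> is empty.\<close>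
  have "feas (\<lambda>_. Max (insert 0 ((\<lambda>(a, b). w a b) ` E)), \<lambda>_. 0)"
    using finE unfolding feas_def by (auto intro!: Max_ge)
  then obtain z where z: "feas z" "\<And>z'. feas z' \<Longrightarrow> obj z \<le> obj z'"
    using ex_has_least_nat[of feas _ obj] by blast
  obtain p q where pq: "z = (p, q)" by fastforce
  have pq_feas: "w a b \<le> p a + q b" if "(a, b) \<in> E" for a b
    using z(1) that by (auto simp: feas_def pq)
  define T where "T a = {b. (a, b) \<in> E \<and> w a b = p a + q b}" for a
  have TB: "T a \<subseteq> B" for a using E by (auto simp: T_def)
  have "\<exists>f. inj_on f A \<and> (\<forall>a\<in>A. f a \<in> T a)"
  proof (rule hall_marriage)
    fix S assume S: "S \<subseteq> A"
    define U where "U = (\<Union>a\<in>S. T a)"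
    have UB: "U \<subseteq> B" unfolding U_def using TB by blast
    \<comment> \<open>Edges from \<open>S\<close> leaving \<open>U\<close> are not tight, so by
      integrality they have slack at least 1 and survive the shift. The value changes by
      \<open>card U - card S\<close>, which minimality forces to be nonnegative.\<close>
    let ?p = "\<lambda>a. p a + (if a \<in> S then -1 else 0)"
    let ?q = "\<lambda>b. q b + (if b \<in> U then 1 else 0)"
    have f: "w a b \<le> ?p a + ?q b" if "(a, b) \<in> E" for a b
      using pq_feas[OF that] that by (auto simp: U_def T_def)
    then have "obj (p, q) \<le> obj (?p, ?q)"
      using z(2)[of "(?p, ?q)"] by (auto simp: feas_def pq)
    moreover have "(\<Sum>(a, b)\<in>M. w a b) \<le> sum p A + sum q B"
      using pq_feas M by (rule weak_duality)
    moreover have "(\<Sum>(a, b)\<in>M. w a b) \<le> sum ?p A + sum ?q B"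
      using f M by (rule weak_duality)
    moreover have "{a \<in> A. a \<in> S} = S" "{b \<in> B. b \<in> U} = U" using S UB by auto
    ultimately show "card S \<le> card U"
      using finA finB by (simp add: obj_def sum_add_indicator)
  qed (use finA finite_subset[OF TB finB] in auto)
  then obtain f where f: "inj_on f A" "\<And>a. a \<in> A \<Longrightarrow> f a \<in> T a" by blast
  have card: "card A = card B"
    using M by (metis card_image matching_def perfect_matching_def)
  have fB: "f ` A = B"
    using f TB finB card by (intro card_subset_eq) (auto simp: card_image)
  let ?N = "(\<lambda>a. (a, f a)) ` A"
  have N: "perfect_matching A B E ?N"
    using f fB unfolding perfect_matching_def matching_def
    by (auto simp: T_def inj_on_def image_image)
  have "(\<Sum>(a, b)\<in>?N. w a b) = (\<Sum>(a, b)\<in>?N. p a + q b)"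
    using f(2) by (intro sum.cong) (auto simp: T_def)
  also have "\<dots> = sum p A + sum q B" using N by (rule sum_perfect_matching)
  finally show thesis using that pq_feas N by blast
qed

section \<open>Bounding the potentials\<close>

text \<open>The \<open>1 - f b\<close> integers from \<open>f b\<close> to 0 are all values of
  \<open>f\<close> on \<open>B\<close>, so there are at most \<open>card B\<close> of them; counting
  0 itself gives the \<open>- 1\<close> in the bound.\<close>

lemma lower_bound_if_no_gaps:
  fixes f :: "'b \<Rightarrow> int"
  assumes "finite B" "b \<in> B" "f b \<le> 0"
    and "\<And>t. f b \<le> t \<Longrightarrow> t \<le> 0 \<Longrightarrow> t \<in> f ` B"
  shows "- (int (card B) - 1) \<le> f b"
proof -
  have "card {f b..0} \<le> card (f ` B)" using assms by (intro card_mono) auto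
  also have "\<dots> \<le> card B" using assms(1) by (rule card_image_le)
  finally show ?thesis using assms(3) by simp
qed

text \<open>
  If some level \<open>t < 0\<close> is not attained by \<open>q\<close> while lower levels are, raising all lower \<open>q b\<close> by one
  and lowering all \<open>p a > - t\<close> by one keeps the solution feasible, because the weights are at most 1;
  it does not increase the objective, because \<open>M\<close> injects the raised objects into the lowered
  agents. A solution with \<open>Max (q ` B) = 0\<close> and \<open>sum q B\<close> maximal thus has no gaps.
\<close>

lemma bounded_dual_solution:
  fixes w :: "'a \<Rightarrow> 'b \<Rightarrow> int"
  assumes G: "bipartite_graph A B E" and M: "perfect_matching A B E M"
    and w1: "\<And>a b. (a, b) \<in> E \<Longrightarrow> w a b \<le> 1"
    and w0: "\<And>a b. (a, b) \<in> M \<Longrightarrow> 0 \<le> w a b"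
    and feas: "\<And>a b. (a, b) \<in> E \<Longrightarrow> w a b \<le> p a + q b"
  obtains p' q' where
    "\<And>a b. (a, b) \<in> E \<Longrightarrow> w a b \<le> p' a + q' b"
    "\<And>a. a \<in> A \<Longrightarrow> p' a \<in> {0..int (card B)}"
    "\<And>b. b \<in> B \<Longrightarrow> q' b \<in> {- (int (card B) - 1)..0}"
    "sum p' A + sum q' B \<le> sum p A + sum q B"
proof -
  have finA: "finite A" and finB: "finite B" and E: "E \<subseteq> A \<times> B"
    using G by (auto simp: bipartite_graph_def)
  have ME: "M \<subseteq> E" and Minj: "inj_on fst M" "inj_on snd M"
    and MA: "fst ` M = A" and MB: "snd ` M = B"
    using M by (auto simp: perfect_matching_def matching_def)
  have card: "card A = card B" using Minj MA MB by (metis card_image)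
  define P where "P = (\<lambda>(p', q'). (\<forall>(a, b)\<in>E. w a b \<le> p' a + q' b) \<and>
    (\<forall>b\<in>B. q' b \<le> 0) \<and> (\<exists>b\<in>B. q' b = 0) \<and>
    sum p' A + sum q' B \<le> sum p A + sum q B)"
  define d where "d = (\<lambda>(p' :: 'a \<Rightarrow> int, q'). nat (- sum q' B))"
  show thesis
  proof (cases "B = {}")
    case True
    then show thesis using that[of p q] finA card E by simp
  next
    case False
    define m where "m = Max (q ` B)"
    have "m \<in> q ` B" unfolding m_def using finB False by (intro Max_in) auto
    \<comment> \<open>Shifting by \<open>m\<close> in opposite directions keeps all edge sums, and
      keeps the objective since the two sides have equal size.\<close>
    then have "P (\<lambda>a. p a + m, \<lambda>b. q b - m)"
      unfolding P_def using feas finB card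
      by (auto simp: sum.distrib sum_subtractf m_def)
    then obtain z where z: "P z" "\<And>z'. P z' \<Longrightarrow> d z \<le> d z'"
      using ex_has_least_nat[of P _ d] by blast
    obtain p' q' where pq: "z = (p', q')" by fastforce
    have feas': "w a b \<le> p' a + q' b" if "(a, b) \<in> E" for a b
      using z(1) that by (auto simp: P_def pq)
    have q0: "q' b \<le> 0" if "b \<in> B" for b using z(1) that by (auto simp: P_def pq)
    have zero: "0 \<in> q' ` B" using z(1) False by (force simp: P_def pq)
    have obj: "sum p' A + sum q' B \<le> sum p A + sum q B" using z(1) by (auto simp: P_def pq)
    have pM: "0 \<le> p' a + q' b" if "(a, b) \<in> M" for a b
      using feas'[of a b] w0[OF that] that ME by fastforce
    have p0: "0 \<le> p' a" if "a \<in> A" for a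
    proof -
      obtain b where b: "(a, b) \<in> M" using \<open>a \<in> A\<close> MA by force
      then show ?thesis using pM[OF b] q0[of b] MB by force
    qed
    have no_gap: "t \<in> q' ` B" if b: "b \<in> B" "q' b \<le> t" and t: "t \<le> 0" for b t
    proof (rule ccontr)
      assume gap: "t \<notin> q' ` B"
      let ?U = "{b \<in> B. q' b < t}" and ?L = "{a \<in> A. p' a > - t}"
      let ?p = "\<lambda>a. p' a + (if p' a > - t then -1 else 0)"
      let ?q = "\<lambda>b. q' b + (if q' b < t then 1 else 0)"
      have "b \<in> ?U" using b gap by force
      then have posU: "card ?U > 0" using finB by (auto simp: card_gt_0_iff)
      \<comment> \<open>An edge of \<open>M\<close> has potential sum at least 0, so if its object
        lies below \<open>t\<close> then its agent lies above \<open>- t\<close>.\<close>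
      define MU where "MU = {e \<in> M. snd e \<in> ?U}"
      have "MU \<subseteq> M" by (auto simp: MU_def)
      then have inj: "inj_on fst MU" "inj_on snd MU"
        using Minj by (auto intro: inj_on_subset)
      have "?U = snd ` MU" using MB by (auto simp: MU_def)
      then have "card ?U = card MU" using inj(2) card_image by metis
      also have "\<dots> = card (fst ` MU)" using inj(1) by (simp add: card_image)
      also have "\<dots> \<le> card ?L"
        using pM MA finA by (intro card_mono) (force simp: MU_def)+
      finally have UL: "card ?U \<le> card ?L" .
      \<comment> \<open>The sum drops only if \<open>p' a > - t\<close> and \<open>q' b\<close> is
        not below \<open>t\<close>. The gap then gives \<open>q' b \<ge> t + 1\<close>, so the old
        sum is at least 2 and the new one at least 1.\<close>
      have "w a b \<le> ?p a + ?q b" if "(a, b) \<in> E" for a b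
      proof -
        have "q' b \<noteq> t" using gap that E by blast
        then show ?thesis using feas'[OF that] w1[OF that] by auto
      qed
      moreover have "?q b \<le> 0" if "b \<in> B" for b using q0[OF that] t by auto
      moreover have "\<exists>b\<in>B. ?q b = 0" using zero t by force
      moreover have "sum ?p A + sum ?q B \<le> sum p A + sum q B"
        using obj UL finA finB by (simp add: sum_add_indicator)
      ultimately have "P (?p, ?q)" unfolding P_def by blast
      then have "d (p', q') \<le> d (?p, ?q)" using z(2) pq by blast
      moreover have "sum q' B \<le> 0" "sum ?q B \<le> 0"
        using q0 t by (auto intro!: sum_nonpos)
      ultimately show False
        using posU finB by (simp add: d_def sum_add_indicator)
    qed
    have ql: "- (int (card B) - 1) \<le> q' b" if "b \<in> B" for b
      using finB that q0[OF that] no_gap[OF that] by (rule lower_bound_if_no_gaps)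
    \<comment> \<open>Where the cap takes effect, the edge sum is still at least
      \<open>card B - (card B - 1) = 1\<close>, the largest possible weight.\<close>
    let ?p = "\<lambda>a. min (p' a) (int (card B))"
    show thesis
    proof (rule that)
      fix a b assume "(a, b) \<in> E"
      then show "w a b \<le> ?p a + q' b"
        using feas'[of a b] w1[of a b] ql[of b] E by (auto simp: min_def)
    next
      have "sum ?p A \<le> sum p' A" by (intro sum_mono) simp
      then show "sum ?p A + sum q' B \<le> sum p A + sum q B" using obj by linarith
    qed (use p0 q0 ql in auto)
  qed
qed

section \<open>Votes between assignments as edge weights\<close>

lemma partner_eq:
  assumes "perfect_matching A B E N" "(a, b) \<in> N"
  shows "partner N a = b"
proof -
  have "inj_on fst N" using assms(1) by (simp add: perfect_matching_def matching_def)
  then have "c = b" if "(a, c) \<in> N" for c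
    using inj_onD[of fst N "(a, c)" "(a, b)"] that assms(2) by simp
  then show ?thesis using assms(2) unfolding partner_def by (rule the_equality[rotated])
qed

text \<open>Both matchings cover all agents, so votes compare partners only. Irreflexivity and
  transitivity exclude opposite votes by one agent, hence the nested conditional in
  \<open>wt\<close> is the difference of the two indicators.\<close>

lemma Delta_eq_sum_wt:
  assumes G: "bipartite_graph A B E" and pr: "preferences A E pref"
    and M: "perfect_matching A B E M" and N: "perfect_matching A B E N"
  shows "Delta A pref N M = (\<Sum>(a, b)\<in>N. wt pref M a b)"
proof -
  have finA: "finite A" using G by (simp add: bipartite_graph_def)
  have mem: "(a, partner K a) \<in> E" if "perfect_matching A B E K" "a \<in> A" for K a
    using that partner_eq[OF that(1)] by (fastforce simp: perfect_matching_def matching_def)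
  have asym: "\<not> (pref a b c \<and> pref a c b)" if "a \<in> A" "(a, b) \<in> E" "(a, c) \<in> E" for a b c
    using pr that unfolding preferences_def neighbors_def irreflp_on_def transp_on_def by blast
  have mt: "matched M a" "matched N a" if "a \<in> A" for a
    using that M N by (auto simp: matched_def perfect_matching_def)
  let ?w = "\<lambda>a. wt pref M a (partner N a)"
  have "(\<Sum>(a, b)\<in>N. wt pref M a b) = (\<Sum>e\<in>N. ?w (fst e))"
    using partner_eq[OF N] by (intro sum.cong) auto
  also have "\<dots> = sum ?w A"
    using N sum.reindex[of fst N ?w] by (simp add: perfect_matching_def matching_def)
  also have "\<dots> = (\<Sum>a\<in>A. (if prefers_matching pref a N M then 1 else 0) +
      (if prefers_matching pref a M N then -1 else 0))"
    using asym[OF _ mem[OF N] mem[OF M]] mt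
    by (intro sum.cong) (auto simp: wt_def prefers_matching_def)
  also have "\<dots> = Delta A pref N M"
    using finA sum_add_indicator[OF finA, of "\<lambda>a. if prefers_matching pref a N M then 1 else 0"
        "\<lambda>a. prefers_matching pref a M N" "-1"]
      sum_add_indicator[OF finA, of "\<lambda>_. 0" "\<lambda>a. prefers_matching pref a N M" 1]
    by (simp add: Delta_def)
  finally show ?thesis by simp
qed

lemma wt_le_one: "wt pref M a b \<le> 1"
  by (simp add: wt_def)

text \<open>There are finitely many perfect matchings and \<open>M\<close> is one of them, so the
  maximum is taken over a finite nonempty set.\<close>

lemma unpopularity_margin_le_iff:
  assumes "bipartite_graph A B E" "perfect_matching A B E M"
  shows "unpopularity_margin A B E pref M \<le> k \<longleftrightarrow>
    (\<forall>N. perfect_matching A B E N \<longrightarrow> Delta A pref N M \<le> k)"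
proof -
  have "finite E" using assms(1) by (metis bipartite_graph_def finite_SigmaI finite_subset)
  then have "finite (Pow E)" by simp
  moreover have "{N. perfect_matching A B E N} \<subseteq> Pow E"
    by (auto simp: perfect_matching_def matching_def)
  ultimately have "finite {N. perfect_matching A B E N}" by (rule finite_subset[rotated])
  then have "finite {Delta A pref N M | N. perfect_matching A B E N}" by simp
  then show ?thesis
    unfolding unpopularity_margin_def using assms(2) by (subst Max_le_iff) auto
qed

theorem theorem13:
  fixes A :: "'a set" and B :: "'b set" and E M :: "('a \<times> 'b) set"
    and pref :: "'a \<Rightarrow> 'b \<Rightarrow> 'b \<Rightarrow> bool" and n k :: nat
  assumes "bipartite_graph A B E"
    and "card A = n" and "card B = n"
    and "preferences A E pref"
    and "perfect_matching A B E M"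
  shows "unpopularity_margin A B E pref M \<le> int k \<longleftrightarrow>
    (\<exists>\<alpha> :: 'a + 'b \<Rightarrow> real.
       LP_feasible E pref M \<alpha> \<and>
       (\<forall>a\<in>A. \<alpha> (Inl a) \<in> real ` {0..n}) \<and>
       (\<forall>b\<in>B. \<alpha> (Inr b) \<in> real_of_int ` {- (int n - 1)..0}) \<and>
       LP_objective A B \<alpha> \<le> real k)"
proof -
  have finA: "finite A" and finB: "finite B" using assms(1) by (auto simp: bipartite_graph_def)
  note Delta = Delta_eq_sum_wt[OF assms(1,4,5)]
  have objective: "LP_objective A B \<alpha> = (\<Sum>a\<in>A. \<alpha> (Inl a)) + (\<Sum>b\<in>B. \<alpha> (Inr b))" for \<alpha>
    using finA finB by (simp add: LP_objective_def sum.Plus)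
  show ?thesis unfolding unpopularity_margin_le_iff[OF assms(1,5)]
  proof (intro iffI allI impI)
    assume pop: "\<forall>N. perfect_matching A B E N \<longrightarrow> Delta A pref N M \<le> int k"
    obtain p q N where pq: "\<And>a b. (a, b) \<in> E \<Longrightarrow> wt pref M a b \<le> p a + q b"
      and N: "perfect_matching A B E N"
      and opt: "(\<Sum>(a, b)\<in>N. wt pref M a b) = sum p A + sum q B"
      using egervary[OF assms(1,5)] by metis
    \<comment> \<open>No agent prefers her own partner to itself, so the edges of \<open>M\<close>
      have nonnegative weight, as the compression of the dual solution requires.\<close>
    have "irreflp_on (neighbors E a) (pref a)" if "a \<in> A" for a
      using assms(4) that by (simp add: preferences_def)
    then have "0 \<le> wt pref M a b" if "(a, b) \<in> M" for a b
      using partner_eq[OF assms(5) that] that assms(5)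
      by (fastforce simp: wt_def perfect_matching_def matching_def neighbors_def irreflp_on_def)
    from bounded_dual_solution[where w = "wt pref M", OF assms(1,5) wt_le_one this pq]
    obtain p' q' where feas: "\<And>a b. (a, b) \<in> E \<Longrightarrow> wt pref M a b \<le> p' a + q' b"
      and p': "\<And>a. a \<in> A \<Longrightarrow> p' a \<in> {0..int (card B)}"
      and q': "\<And>b. b \<in> B \<Longrightarrow> q' b \<in> {- (int (card B) - 1)..0}"
      and le: "sum p' A + sum q' B \<le> sum p A + sum q B"
      by blast
    define \<alpha> where "\<alpha> = case_sum (\<lambda>a. real_of_int (p' a)) (\<lambda>b. real_of_int (q' b))"
    have "LP_feasible E pref M \<alpha>"
      using feas unfolding LP_feasible_def \<alpha>_def
      by (auto simp flip: of_int_add)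
    moreover have "\<alpha> (Inl a) \<in> real ` {0..n}" if "a \<in> A" for a
      using p'[OF that] assms(3) by (intro image_eqI[of _ _ "nat (p' a)"]) (auto simp: \<alpha>_def)
    moreover have "\<forall>b\<in>B. \<alpha> (Inr b) \<in> real_of_int ` {- (int n - 1)..0}"
      using q' assms(3) by (auto simp: \<alpha>_def)
    moreover have "LP_objective A B \<alpha> \<le> real k"
    proof -
      \<comment> \<open>The optimal dual value is the weight of \<open>N\<close>, that is
        \<open>Delta A pref N M\<close>, which the margin bounds by \<open>k\<close>.\<close>
      have "sum p' A + sum q' B \<le> int k" using pop N Delta[OF N] opt le by force
      moreover have "LP_objective A B \<alpha> = real_of_int (sum p' A + sum q' B)"
        by (simp add: objective \<alpha>_def)
      ultimately show ?thesis by linarith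
    qed
    ultimately show "\<exists>\<alpha>. LP_feasible E pref M \<alpha> \<and>
       (\<forall>a\<in>A. \<alpha> (Inl a) \<in> real ` {0..n}) \<and>
       (\<forall>b\<in>B. \<alpha> (Inr b) \<in> real_of_int ` {- (int n - 1)..0}) \<and>
       LP_objective A B \<alpha> \<le> real k" by blast
  next
    fix N assume ex: "\<exists>\<alpha>. LP_feasible E pref M \<alpha> \<and>
       (\<forall>a\<in>A. \<alpha> (Inl a) \<in> real ` {0..n}) \<and>
       (\<forall>b\<in>B. \<alpha> (Inr b) \<in> real_of_int ` {- (int n - 1)..0}) \<and>
       LP_objective A B \<alpha> \<le> real k"
      and N: "perfect_matching A B E N"
    then obtain \<alpha> where \<alpha>: "LP_feasible E pref M \<alpha>" "LP_objective A B \<alpha> \<le> real k" by blast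
    \<comment> \<open>The converse is weak duality over the reals: \<open>\<alpha>\<close> bounds
      the weight of every perfect matching.\<close>
    have "real_of_int (Delta A pref N M) = (\<Sum>(a, b)\<in>N. real_of_int (wt pref M a b))"
      using Delta[OF N] by (simp add: split_def)
    also have "\<dots> \<le> LP_objective A B \<alpha>"
      unfolding objective using \<alpha>(1) N by (intro weak_duality) (auto simp: LP_feasible_def)
    finally show "Delta A pref N M \<le> int k" using \<alpha>(2) by linarith
  qed
qed

end
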